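(* Let $N\ge 2$ be an integer and let $a<b$ be real numbers. Assume that for every test function $\varphi\in C_c^\infty(\mathbb{R})$ the functional $\Psi(x)=\mathbb{E}_x\big(\varphi(X_{\tau_{ab}})\mathbf{1}_{\{\tau_{ab}<+\infty\}}\big)$, $x\in(a,b)$ (defined in the context), solves the boundary value problem $\Psi^{(2N)}(x)=0$ for $x\in(a,b)$, $\Psi^{(k)}(a)=\varphi^{(k)}(a)$ and $\Psi^{(k)}(b)=\varphi^{(k)}(b)$ for $0\le k\le N-1$. Then, for $x\in(a,b)$, the pseudo-distribution of the exit location $X_{\tau_{ab}}\mathbf{1}_{\{\tau_{ab}<+\infty\}}$ is given, in the sense of Schwartz distributions, by $$\mathbb{P}_x\{X_{\tau_{ab}}\in\mathrm{d}z,\tau_{ab}<+\infty\}/\mathrm{d}z=\sum_{k=0}^{N-1}(-1)^kH_k^-(x)\,\delta_a^{(k)}(z)+\sum_{k=0}^{N-1}(-1)^kH_k^+(x)\,\delta_b^{(k)}(z),$$ that is, for every $\varphi\in C_c^\infty(\mathbb{R})$, $$\mathbb{E}_x\big(\varphi(X_{\tau_{ab}})\mathbf{1}_{\{\tau_{ab}<+\infty\}}\big)=\sum_{k=0}^{N-1}H_k^-(x)\,\varphi^{(k)}(a)+\sum_{k=0}^{N-1}H_k^+(x)\,\varphi^{(k)}(b),$$ where $H_k^\pm$, $0\le k\le N-1$, are the Hermite interpolating polynomials of degree at most $2N-1$ related to the points $a$ and $b$, i.e. those satisfying, for $0\le\ell\le N-1$, $(H_k^-)^{(\ell)}(a)=(H_k^+)^{(\ell)}(b)=\delta_{k\ell}$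 and $(H_k^+)^{(\ell)}(a)=(H_k^-)^{(\ell)}(b)=0$; explicitly $$H_k^-(x)=\Big(\frac{b-x}{b-a}\Big)^{N}\frac{(x-a)^k}{k!}\sum_{\ell=0}^{N-k-1}\binom{\ell+N-1}{\ell}\Big(\frac{x-a}{b-a}\Big)^{\ell},\qquad H_k^+(x)=\Big(\frac{x-a}{b-a}\Big)^{N}\frac{(x-b)^k}{k!}\sum_{\ell=0}^{N-k-1}\binom{\ell+N-1}{\ell}\Big(\frac{b-x}{b-a}\Big)^{\ell}.$$
   Context: Pseudo-process. For $t>0$, $p(t;\cdot)$ is the function with $\int_{-\infty}^{+\infty}\mathrm{e}^{\mathrm{i}ux}p(t;x)\,\mathrm{d}x=\mathrm{e}^{-tu^{2N}}$ (a signed kernel), and $p(t;x,y)=p(t;x-y)$. The pseudo-process $(X_t)_{t\ge0}$ started at $x$ has the signed finite-dimensional distributions $\mathbb{P}_x\{X_{t_1}\in\mathrm{d}x_1,\dots,X_{t_n}\in\mathrm{d}x_n\}=\prod_{k=1}^n p(t_k-t_{k-1};x_{k-1},x_k)\,\mathrm{d}x_1\cdots\mathrm{d}x_n$ for $0=t_0<t_1<\dots<t_n$, $x_0=x$. Functional. $\tau_{ab}=\inf\{t\ge0:X_t\notin(a,b)\}$ is approximated by $\tau_{ab,n}=2^{-n}\min\{k\in\mathbb{N}:X_{k/2^n}\notin(a,b)\}$. For $x\in(a,b)$, $$\Psi_n(x)=\mathbb{E}_x\big(\varphi(X_{\tau_{ab,n}})\mathbf{1}_{\{\tau_{ab,n}<+\infty\}}\big)=\sum_{k\ge1}\int_{(a,b)^{k-1}\times(\mathbb{R}\setminus(a,b))}\varphi(x_k)\prod_{j=1}^k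 p(2^{-n};x_{j-1},x_j)\,\mathrm{d}x_1\cdots\mathrm{d}x_k\quad(x_0=x),$$ and by definition $\mathbb{E}_x\big(\varphi(X_{\tau_{ab}})\mathbf{1}_{\{\tau_{ab}<+\infty\}}\big)=\Psi(x)=\lim_{n\to\infty}\Psi_n(x)$ (the limit being assumed to exist). Values of $\Psi$ and its derivatives at $a$, $b$ are one-sided limits from inside $(a,b)$. Distributions. $\delta_a^{(k)}$ acts on test functions by $\langle\delta_a^{(k)},\varphi\rangle=(-1)^k\varphi^{(k)}(a)$. $\delta_{k\ell}$ is the Kronecker symbol. *)

theory Defs
  imports "HOL-Analysis.Analysis" "HOL-Computational_Algebra.Polynomial"
begin

(* The Fourier transform fixes p t only up to a Lebesgue null set; everything below depends on
   p t through integrals only, so the choice of representative is immaterial. *)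
definition pseudo_kernel :: "nat \<Rightarrow> (real \<Rightarrow> real \<Rightarrow> real) \<Rightarrow> bool" where
  "pseudo_kernel N p \<longleftrightarrow> (\<forall>t>0. integrable lborel (p t) \<and>
     (\<forall>u::real. (LINT x|lborel. exp (\<i> * of_real (u * x)) * complex_of_real (p t x))
                 = complex_of_real (exp (- t * u ^ (2 * N)))))"

(* E_x F(X_{t 0}, ..., X_{t k}) under the signed finite-dimensional distributions, for times
   0 = t 0 < ... < t k.  Coordinate j of the path y is X_{t j}; the integration variables are
   the coordinates 1, ..., k, and coordinate 0 is set to the starting point x. *)
definition pseudo_expectation ::
  "(real \<Rightarrow> real \<Rightarrow> real) \<Rightarrow> real \<Rightarrow> (nat \<Rightarrow> real) \<Rightarrow> nat \<Rightarrow> ((nat \<Rightarrow> real) \<Rightarrow> real) \<Rightarrow> real" where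
  "pseudo_expectation p x t k F =
     (LINT y|Pi\<^sub>M {1..k} (\<lambda>_. lborel).
        F (y(0 := x)) * (\<Prod>j=1..k. p (t j - t (j - 1)) ((y(0 := x)) (j - 1) - (y(0 := x)) j)))"

definition first_exit_at :: "real \<Rightarrow> real \<Rightarrow> nat \<Rightarrow> (nat \<Rightarrow> real) set" where
  "first_exit_at a b k = {y. (\<forall>j<k. y j \<in> {a<..<b}) \<and> y k \<notin> {a<..<b}}"

(* Psi_n: the k-th summand is the contribution of the event that the discretised exit time
   equals (k + 1) / 2^n.  For a compactly supported continuous phi the series converges
   absolutely, since p (1 / 2^n) compressed to (a,b) is a strict contraction of L^2. *)
definition approx_exit_expectation ::
  "(real \<Rightarrow> real \<Rightarrow> real) \<Rightarrow> real \<Rightarrow> real \<Rightarrow> (real \<Rightarrow> real) \<Rightarrow> nat \<Rightarrow> real \<Rightarrow> real" where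
  "approx_exit_expectation p a b \<phi> n x =
     (\<Sum>k. pseudo_expectation p x (\<lambda>j. real j / 2 ^ n) (Suc k)
              (\<lambda>y. \<phi> (y (Suc k)) * indicator (first_exit_at a b (Suc k)) y))"

(* Meaningful only when the limit exists; its existence is a separate hypothesis. *)
definition exit_expectation ::
  "(real \<Rightarrow> real \<Rightarrow> real) \<Rightarrow> real \<Rightarrow> real \<Rightarrow> (real \<Rightarrow> real) \<Rightarrow> real \<Rightarrow> real" where
  "exit_expectation p a b \<phi> x = lim (\<lambda>n. approx_exit_expectation p a b \<phi> n x)"

definition test_function :: "(real \<Rightarrow> real) \<Rightarrow> bool" where
  "test_function \<phi> \<longleftrightarrow> (\<forall>k x. (deriv ^^ k) \<phi> field_differentiable at x)
                      \<and> compact (closure {x. \<phi> x \<noteq> 0})"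

definition dirac_deriv :: "nat \<Rightarrow> real \<Rightarrow> (real \<Rightarrow> real) \<Rightarrow> real" where
  "dirac_deriv k c \<phi> = (-1) ^ k * (deriv ^^ k) \<phi> c"

definition distribution_eq ::
  "((real \<Rightarrow> real) \<Rightarrow> real) \<Rightarrow> ((real \<Rightarrow> real) \<Rightarrow> real) \<Rightarrow> bool" where
  "distribution_eq T S \<longleftrightarrow> (\<forall>\<phi>. test_function \<phi> \<longrightarrow> T \<phi> = S \<phi>)"

(* Only the values of \<Psi> on (a,b) matter; boundary values are one-sided limits from inside. *)
definition solves_exit_bvp ::
  "nat \<Rightarrow> real \<Rightarrow> real \<Rightarrow> (real \<Rightarrow> real) \<Rightarrow> (real \<Rightarrow> real) \<Rightarrow> bool" where
  "solves_exit_bvp N a b \<phi> \<Psi> \<longleftrightarrow>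
     (\<forall>k<2*N. \<forall>x\<in>{a<..<b}. (deriv ^^ k) \<Psi> field_differentiable at x) \<and>
     (\<forall>x\<in>{a<..<b}. (deriv ^^ (2*N)) \<Psi> x = 0) \<and>
     (\<forall>k<N. ((deriv ^^ k) \<Psi> \<longlongrightarrow> (deriv ^^ k) \<phi> a) (at_right a) \<and>
            ((deriv ^^ k) \<Psi> \<longlongrightarrow> (deriv ^^ k) \<phi> b) (at_left b))"

(* c is the node at which the k-th derivative is 1, d the other node: H_k^- has (c,d) = (a,b)
   and H_k^+ has (c,d) = (b,a). *)
definition is_hermite :: "nat \<Rightarrow> real \<Rightarrow> real \<Rightarrow> nat \<Rightarrow> real poly \<Rightarrow> bool" where
  "is_hermite N c d k P \<longleftrightarrow> degree P \<le> 2 * N - 1 \<and>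
     (\<forall>l<N. poly ((pderiv ^^ l) P) c = (if k = l then 1 else 0) \<and>
            poly ((pderiv ^^ l) P) d = 0)"

definition hermite_minus :: "nat \<Rightarrow> real \<Rightarrow> real \<Rightarrow> nat \<Rightarrow> real poly" where
  "hermite_minus N a b k = (THE P. is_hermite N a b k P)"

definition hermite_plus :: "nat \<Rightarrow> real \<Rightarrow> real \<Rightarrow> nat \<Rightarrow> real poly" where
  "hermite_plus N a b k = (THE P. is_hermite N b a k P)"

end

theory Submission
  imports Defs
begin

text \<open>
  Everything probabilistic is contained in the hypothesis that \<open>\<Psi>\<close> solves the boundary value
  problem, so the theorem is one about two-point Hermite interpolation.  On \<open>(a,b)\<close> the
  equation \<open>\<Psi>\<^sup>(\<^sup>2\<^sup>N\<^sup>) = 0\<close> makes \<open>\<Psi>\<close> a polynomial of degree less than \<open>2N\<close>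
  (\<open>vanishing_deriv_imp_polynomial\<close>); since polynomials and their derivatives are continuous
  up to the endpoints, the one-sided limits say that this polynomial has the same jets of order
  \<open>N\<close> at \<open>a\<close> and at \<open>b\<close> as \<open>\<phi>\<close>.

  A polynomial of degree less than \<open>2N\<close> is determined by those two jets, because the difference
  of two candidates would have two roots of multiplicity \<open>N\<close> (\<open>two_jets_determine_poly\<close>).
  This gives the uniqueness of the Hermite polynomials, and shows that \<open>\<Psi>\<close> is the combination
  of Hermite polynomials with coefficients \<open>\<phi>\<^sup>(\<^sup>k\<^sup>)(a)\<close> and \<open>\<phi>\<^sup>(\<^sup>k\<^sup>)(b)\<close>.

  The explicit formula rests on the binomial series
  \<open>(1 - u)\<^sup>-\<^sup>N = (\<Sum>l. (l+N-1 choose l) u\<^sup>l)\<close>.  With \<open>u = (x-c)/(d-c)\<close>, the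
  factor \<open>(1 - u)\<^sup>N\<close> makes the polynomial vanish to order \<open>N\<close> at \<open>d\<close>, and the truncated
  series cancels the effect of this factor at \<open>c\<close> up to terms of order \<open>(x-c)\<^sup>N\<close>, so that
  only the jet of \<open>(x-c)\<^sup>k/k!\<close> is left there (\<open>is_hermite_explicit\<close>).
\<close>

section \<open>Jets of polynomials\<close>

text \<open>
  Both sides pass from \<open>P\<close> to \<open>P'\<close> with the order lowered by one, provided that \<open>P(c) = 0\<close>;
  characteristic zero ensures that differentiation lowers the multiplicity by exactly one.
\<close>

lemma power_dvd_iff_jet_zero:
  fixes P :: "'a::field_char_0 poly"
  shows "[:-c, 1:] ^ n dvd P \<longleftrightarrow> (\<forall>l<n. poly ((pderiv ^^ l) P) c = 0)"
proof (induction n arbitrary: P)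
  case 0
  show ?case by simp
next
  case (Suc n)
  have split: "(\<forall>l<Suc n. poly ((pderiv ^^ l) P) c = 0) \<longleftrightarrow>
      poly P c = 0 \<and> (\<forall>l<n. poly ((pderiv ^^ l) (pderiv P)) c = 0)"
    by (auto simp: less_Suc_eq_0_disj funpow_swap1)
  show ?case
  proof (cases "P \<noteq> 0 \<and> poly P c = 0")
    case True
    then have "order c P = Suc (order c (pderiv P))"
      by (intro order_pderiv) auto
    moreover have "pderiv P \<noteq> 0"
      using True by (metis pderiv_iszero poly_pCons poly_0 mult_zero_right add.right_neutral pCons_0_0)
    ultimately show ?thesis
      using True unfolding split Suc.IH[symmetric] order_divides by simp
  next
    case False
    then show ?thesis
      unfolding split order_divides by (auto simp: order_root)
  qed
qed

lemma jet_power: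
  fixes c :: "'a::field_char_0"
  shows "poly ((pderiv ^^ l) ([:-c, 1:] ^ k)) c = (if k = l then fact k else 0)"
proof (induction l arbitrary: k)
  case 0
  show ?case by (cases k) auto
next
  case (Suc l)
  show ?case
  proof (cases k)
    case 0
    then show ?thesis by (simp add: funpow_Suc_right del: funpow.simps)
  next
    case (Suc m)
    have "(pderiv ^^ Suc l) ([:-c, 1:] ^ Suc m)
        = smult (of_nat (Suc m)) ((pderiv ^^ l) ([:-c, 1:] ^ m))"
      by (simp add: funpow_Suc_right pderiv_power_Suc pderiv_pCons higher_pderiv_smult del: funpow.simps of_nat_Suc power_Suc)
    then show ?thesis
      using Suc.IH[of m] Suc by (simp del: funpow.simps power_Suc)
  qed
qed

lemma two_jets_determine_poly:
  fixes P Q :: "real poly"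
  assumes "N \<ge> 1" "c \<noteq> d"
    and "degree P \<le> 2 * N - 1" "degree Q \<le> 2 * N - 1"
    and "\<And>l. l < N \<Longrightarrow> poly ((pderiv ^^ l) P) c = poly ((pderiv ^^ l) Q) c"
    and "\<And>l. l < N \<Longrightarrow> poly ((pderiv ^^ l) P) d = poly ((pderiv ^^ l) Q) d"
  shows "P = Q"
proof (rule ccontr)
  define R where "R = P - Q"
  assume "P \<noteq> Q"
  then have "R \<noteq> 0" by (simp add: R_def)
  have jet: "(pderiv ^^ l) R = (pderiv ^^ l) P - (pderiv ^^ l) Q" for l
    using higher_pderiv_add[of l "P - Q" Q] by (simp add: R_def)
  have "[:-c, 1:] ^ N dvd R" "[:-d, 1:] ^ N dvd R"
    unfolding power_dvd_iff_jet_zero jet using assms by auto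
  then have ord: "N \<le> order c R" "N \<le> order d R"
    using \<open>R \<noteq> 0\<close> by (auto simp: order_divides)
  then have roots: "{c, d} \<subseteq> {x. poly R x = 0}"
    using \<open>N \<ge> 1\<close> \<open>R \<noteq> 0\<close> by (auto simp: order_root)
  have "2 * N \<le> (\<Sum>x\<in>{c, d}. order x R)"
    using ord \<open>c \<noteq> d\<close> by simp
  also have "\<dots> \<le> (\<Sum>x | poly R x = 0. order x R)"
    using roots \<open>R \<noteq> 0\<close> by (intro sum_mono2) (auto simp: poly_roots_finite)
  also have "\<dots> \<le> degree R"
    by (rule sum_order_le_degree[OF \<open>R \<noteq> 0\<close>])
  also have "degree R \<le> 2 * N - 1"
    unfolding R_def using assms by (intro degree_diff_le) auto
  finally show False using \<open>N \<ge> 1\<close> by linarith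
qed

section \<open>The explicit Hermite polynomials\<close>

text \<open>
  The partial sums of the binomial series invert \<open>(1 - u)\<^sup>N\<close> modulo \<open>u\<^sup>M\<close>.  Multiplying the
  sum for \<open>N + 1\<close> by \<open>1 - u\<close> telescopes, by Pascal's rule, to the sum for \<open>N\<close> up to a multiple
  of \<open>u\<^sup>M\<close>.  For \<open>N = 0\<close>, truncated subtraction leaves only the term with \<open>l = 0\<close>.
\<close>

lemma negative_binomial_truncated_inverse:
  fixes u :: "'a::comm_ring_1"
  shows "u ^ M dvd (1 - u) ^ N * (\<Sum>l<M. of_nat ((l + N - 1) choose l) * u ^ l) - 1"
proof (induction N)
  case 0
  show ?case
  proof (cases M)
    case 0
    then show ?thesis by simp
  next
    case (Suc m)
    then show ?thesis by (simp add: sum.lessThan_Suc_shift binomial_eq_0 del: sum.lessThan_Suc)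
  qed
next
  case (Suc N)
  define S where "S n M = (\<Sum>l<M. of_nat ((l + n - 1) choose l) * u ^ l)" for n M :: nat
  have step: "\<exists>r. (1 - u) * S (Suc N) M = S N M + r * u ^ M"
  proof (cases M)
    case 0
    then show ?thesis by (auto simp: S_def)
  next
    case (Suc m)
    have "(1 - u) * S (Suc N) (Suc m) = S N (Suc m) - of_nat ((m + N) choose m) * u ^ Suc m"
    proof (induction m)
      case 0
      show ?case by (simp add: S_def)
    next
      case (Suc m)
      have pascal: "(Suc m + N) choose Suc m = ((m + N) choose m) + ((m + N) choose Suc m)"
        by simp
      have "S (Suc N) (Suc (Suc m)) = S (Suc N) (Suc m) + of_nat ((Suc m + N) choose Suc m) * u ^ Suc m"
        and "S N (Suc (Suc m)) = S N (Suc m) + of_nat ((m + N) choose Suc m) * u ^ Suc m"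
        by (simp_all add: S_def)
      then show ?case
        using Suc unfolding pascal by (simp add: algebra_simps)
    qed
    then show ?thesis
      using Suc by (intro exI[of _ "- of_nat ((m + N) choose m)"]) simp
  qed
  then obtain r where r: "(1 - u) * S (Suc N) M = S N M + r * u ^ M" ..
  have "(1 - u) ^ Suc N * S (Suc N) M - 1 = ((1 - u) ^ N * S N M - 1) + u ^ M * ((1 - u) ^ N * r)"
    using arg_cong[OF r, of "\<lambda>z. (1 - u) ^ N * z"] by (simp add: algebra_simps)
  moreover have "u ^ M dvd (1 - u) ^ N * S N M - 1"
    using Suc.IH by (simp add: S_def)
  ultimately have "u ^ M dvd (1 - u) ^ Suc N * S (Suc N) M - 1"
    by (simp only: dvd_add dvd_triv_left)
  then show ?case
    by (simp only: S_def)
qed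

definition hermite_explicit :: "nat \<Rightarrow> real \<Rightarrow> real \<Rightarrow> nat \<Rightarrow> real poly" where
  "hermite_explicit N c d k =
     (let u = smult (1 / (d - c)) [:-c, 1:]
      in (1 - u) ^ N * smult (1 / fact k) ([:-c, 1:] ^ k)
         * (\<Sum>l<N - k. of_nat ((l + N - 1) choose l) * u ^ l))"

lemma poly_hermite_explicit:
  assumes "c \<noteq> d" "k < N"
  shows "poly (hermite_explicit N c d k) x
    = ((d - x) / (d - c)) ^ N * ((x - c) ^ k / fact k)
      * (\<Sum>l = 0..N - k - 1. real ((l + N - 1) choose l) * ((x - c) / (d - c)) ^ l)"
proof -
  define u where "u = smult (1 / (d - c)) [:-c, 1:]"
  have u: "poly u x = (x - c) / (d - c)"
    by (simp add: u_def diff_divide_distrib)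
  have u': "1 - (x - c) / (d - c) = (d - x) / (d - c)"
    using assms by (simp add: field_simps)
  have "{..<N - k} = {0..N - k - 1}"
    using assms by auto
  then have "poly (hermite_explicit N c d k) x = (1 - poly u x) ^ N * ((x - c) ^ k / fact k)
      * (\<Sum>l = 0..N - k - 1. real ((l + N - 1) choose l) * poly u x ^ l)"
    unfolding hermite_explicit_def u_def[symmetric] Let_def by (simp add: poly_sum)
  then show ?thesis
    unfolding u u' .
qed

text \<open>
  The factors \<open>1 - u\<close> and \<open>u\<close> are proportional to \<open>x - d\<close> and \<open>x - c\<close>.  The first gives the
  zero jet at \<open>d\<close>; for the second, the truncated inverse modulo \<open>u\<^sup>N\<^sup>-\<^sup>k\<close>, multiplied by
  \<open>(x - c)\<^sup>k/k!\<close>, leaves exactly this monomial modulo \<open>(x - c)\<^sup>N\<close>.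
\<close>

lemma is_hermite_explicit:
  assumes "c \<noteq> d" "k < N"
  shows "is_hermite N c d k (hermite_explicit N c d k)"
proof -
  define u where "u = smult (1 / (d - c)) [:-c, 1:]"
  define B where "B = (\<Sum>l<N - k. of_nat ((l + N - 1) choose l) * u ^ l)"
  define m where "m = smult (1 / fact k) ([:-c, 1:] ^ k)"
  define H where "H = hermite_explicit N c d k"
  have H: "H = (1 - u) ^ N * m * B"
    by (simp add: H_def hermite_explicit_def u_def B_def m_def Let_def)
  have u': "1 - u = smult (- 1 / (d - c)) [:-d, 1:]"
    using assms by (simp add: u_def one_pCons field_simps)

  have deg_lin: "degree u \<le> 1" "degree (1 - u) \<le> 1"
    unfolding u' by (simp_all add: u_def)
  have "degree ((1 - u) ^ N) \<le> N"
    using degree_power_le[of "1 - u" N] deg_lin(2) mult_le_mono1[of "degree (1 - u)" 1 N] by linarith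
  moreover have "degree m \<le> k"
    using degree_power_le[of "[:-c, 1:]" k] by (simp add: m_def)
  moreover have "degree B \<le> N - k - 1"
    unfolding B_def
  proof (intro degree_sum_le)
    fix l assume l: "l \<in> {..<N - k}"
    have "degree (of_nat ((l + N - 1) choose l) * u ^ l) \<le> degree (u ^ l)"
      by (metis degree_smult_le of_nat_poly mult_smult_left mult.left_neutral smult_one)
    also have "\<dots> \<le> l"
      using degree_power_le[of u l] deg_lin(1) mult_le_mono1[of "degree u" 1 l] by linarith
    finally show "degree (of_nat ((l + N - 1) choose l) * u ^ l) \<le> N - k - 1"
      using l by simp
  qed simp
  ultimately have deg: "degree H \<le> 2 * N - 1"
    using degree_mult_le[of "(1 - u) ^ N * m" B] degree_mult_le[of "(1 - u) ^ N" m] assms(2)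
    unfolding H by linarith

  have "[:-d, 1:] ^ N dvd (1 - u) ^ N"
    unfolding u' smult_power by (intro dvd_smult dvd_refl)
  then have "[:-d, 1:] ^ N dvd H"
    unfolding H mult.assoc by (rule dvd_mult2)
  then have jet_d: "poly ((pderiv ^^ l) H) d = 0" if "l < N" for l
    using that power_dvd_iff_jet_zero by blast

  have "[:-c, 1:] ^ (N - k) dvd u ^ (N - k)"
    unfolding u_def smult_power by (intro dvd_smult dvd_refl)
  also have "\<dots> dvd (1 - u) ^ N * B - 1"
    unfolding B_def by (rule negative_binomial_truncated_inverse)
  finally have "[:-c, 1:] ^ k * [:-c, 1:] ^ (N - k) dvd m * ((1 - u) ^ N * B - 1)"
    unfolding m_def by (intro mult_dvd_mono dvd_smult) auto
  moreover have "m * ((1 - u) ^ N * B - 1) = H - m"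
    by (simp add: H algebra_simps)
  ultimately have "[:-c, 1:] ^ N dvd H - m"
    using assms(2) by (simp add: power_add[symmetric])
  then have diff: "poly ((pderiv ^^ l) (H - m)) c = 0" if "l < N" for l
    using that power_dvd_iff_jet_zero by blast
  have jet_c: "poly ((pderiv ^^ l) H) c = (if k = l then 1 else 0)" if "l < N" for l
  proof -
    have "poly ((pderiv ^^ l) H) c = poly ((pderiv ^^ l) m) c"
      using diff[OF that] higher_pderiv_add[of l "H - m" m] by simp
    then show ?thesis
      by (simp add: m_def higher_pderiv_smult jet_power)
  qed
  show ?thesis
    using deg jet_c jet_d by (simp add: is_hermite_def H_def)
qed

lemma is_hermite_unique:
  assumes "c \<noteq> d" "k < N" "is_hermite N c d k P" "is_hermite N c d k Q"
  shows "P = Q"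
  using assms by (intro two_jets_determine_poly[of N c d]) (auto simp: is_hermite_def)

lemma hermite_eq_explicit:
  assumes "a < b" "k < N"
  shows "hermite_minus N a b k = hermite_explicit N a b k"
    and "hermite_plus N a b k = hermite_explicit N b a k"
proof -
  have "(THE P. is_hermite N c d k P) = hermite_explicit N c d k" if "c \<noteq> d" for c d
    using is_hermite_explicit[OF that assms(2)] is_hermite_unique[OF that assms(2)] by blast
  then show "hermite_minus N a b k = hermite_explicit N a b k"
    and "hermite_plus N a b k = hermite_explicit N b a k"
    using assms(1) by (simp_all add: hermite_minus_def hermite_plus_def)
qed

text \<open>The interpolation formula: the right-hand side has the same two jets as \<open>P\<close>.\<close>

lemma hermite_interpolation:
  fixes P :: "real poly"
  assumes "N \<ge> 1" "a \<noteq> b" "degree P \<le> 2 * N - 1"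
    and A: "\<And>k. k < N \<Longrightarrow> is_hermite N a b k (A k)"
    and B: "\<And>k. k < N \<Longrightarrow> is_hermite N b a k (B k)"
  shows "P = (\<Sum>k<N. smult (poly ((pderiv ^^ k) P) a) (A k))
           + (\<Sum>k<N. smult (poly ((pderiv ^^ k) P) b) (B k))" (is "P = ?Q")
proof (rule two_jets_determine_poly[of N a b])
  have "degree (smult r (A k)) \<le> 2 * N - 1" "degree (smult r (B k)) \<le> 2 * N - 1"
    if "k < N" for k r
    using A[OF that] B[OF that] degree_smult_le[of r] order.trans by (force simp: is_hermite_def)+
  then show "degree ?Q \<le> 2 * N - 1"
    by (intro degree_add_le degree_sum_le) auto
next
  fix l assume l: "l < N"
  have jets: "poly ((pderiv ^^ l) (A k)) a = (if k = l then 1 else 0)"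
    "poly ((pderiv ^^ l) (A k)) b = 0" "poly ((pderiv ^^ l) (B k)) a = 0"
    "poly ((pderiv ^^ l) (B k)) b = (if k = l then 1 else 0)" if "k < N" for k
    using A[OF that] B[OF that] l by (auto simp: is_hermite_def)
  show "poly ((pderiv ^^ l) P) a = poly ((pderiv ^^ l) ?Q) a"
    and "poly ((pderiv ^^ l) P) b = poly ((pderiv ^^ l) ?Q) b"
    using l by (simp_all add: higher_pderiv_add higher_pderiv_sum higher_pderiv_smult poly_sum
        jets if_distrib[of "(*) _"] cong: if_cong)
qed (use assms in auto)

section \<open>The boundary value problem\<close>

text \<open>
  Taylor's formula at the midpoint has a vanishing remainder, so the Taylor polynomial equals
  \<open>f\<close> on the whole interval.
\<close>

lemma vanishing_deriv_imp_polynomial: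
  fixes f :: "real \<Rightarrow> real"
  assumes "n > 0" "a < b"
    and diff: "\<And>k x. k < n \<Longrightarrow> x \<in> {a<..<b} \<Longrightarrow> (deriv ^^ k) f field_differentiable at x"
    and zero: "\<And>x. x \<in> {a<..<b} \<Longrightarrow> (deriv ^^ n) f x = 0"
  obtains P where "degree P \<le> n - 1" "\<And>x. x \<in> {a<..<b} \<Longrightarrow> f x = poly P x"
proof
  define c where "c = (a + b) / 2"
  have c: "a < c" "c < b"
    using \<open>a < b\<close> by (auto simp: c_def)
  define P where "P = (\<Sum>m<n. smult ((deriv ^^ m) f c / fact m) ([:-c, 1:] ^ m))"
  show "degree P \<le> n - 1"
    unfolding P_def
  proof (intro degree_sum_le)
    fix m assume "m \<in> {..<n}"
    then show "degree (smult ((deriv ^^ m) f c / fact m) ([:-c, 1:] ^ m)) \<le> n - 1"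
      using degree_smult_le[of "(deriv ^^ m) f c / fact m" "[:-c, 1:] ^ m"]
        degree_power_le[of "[:-c, 1:]" m] by auto
  qed simp
  have P: "poly P x = (\<Sum>m<n. (deriv ^^ m) f c / fact m * (x - c) ^ m)" for x
    by (simp add: P_def poly_sum)
  fix x assume x: "x \<in> {a<..<b}"
  show "f x = poly P x"
  proof (cases "x = c")
    case True
    then show ?thesis
      using \<open>n > 0\<close> by (cases n) (simp_all add: P sum.lessThan_Suc_shift del: sum.lessThan_Suc)
  next
    case False
    have "\<forall>m t. m < n \<and> min x c \<le> t \<and> t \<le> max x c \<longrightarrow>
        DERIV ((deriv ^^ m) f) t :> (deriv ^^ Suc m) f t"
    proof (intro allI impI)
      fix m t assume mt: "m < n \<and> min x c \<le> t \<and> t \<le> max x c"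
      then have "t \<in> {a<..<b}" using x c by auto
      then show "DERIV ((deriv ^^ m) f) t :> (deriv ^^ Suc m) f t"
        using diff mt by (simp add: DERIV_deriv_iff_field_differentiable)
    qed
    then obtain t where t: "if x < c then x < t \<and> t < c else c < t \<and> t < x"
      and "f x = (\<Sum>m<n. (deriv ^^ m) f c / fact m * (x - c) ^ m)
            + (deriv ^^ n) f t / fact n * (x - c) ^ n"
      using Taylor[of n "\<lambda>m. (deriv ^^ m) f" f "min x c" "max x c" c x] \<open>n > 0\<close> False by auto
    moreover have "t \<in> {a<..<b}"
      using t x c by (auto split: if_splits)
    ultimately show ?thesis
      by (simp add: P zero)
  qed
qed

lemma higher_deriv_eq_poly:
  fixes f :: "real \<Rightarrow> real"
  assumes "\<And>x. x \<in> {a<..<b} \<Longrightarrow> f x = poly P x" "x \<in> {a<..<b}"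
  shows "(deriv ^^ k) f x = poly ((pderiv ^^ k) P) x"
  using assms(2)
proof (induction k arbitrary: x)
  case 0
  then show ?case using assms(1) by simp
next
  case (Suc k)
  have "((deriv ^^ k) f has_field_derivative poly (pderiv ((pderiv ^^ k) P)) x) (at x)"
    by (rule has_field_derivative_transform_within_open[OF poly_DERIV, of "{a<..<b}"])
      (use Suc in auto)
  then show ?case
    by (simp add: DERIV_imp_deriv)
qed

lemma exit_bvp_solution:
  assumes "N \<ge> 1" "a < b" "solves_exit_bvp N a b \<phi> \<Psi>" "x \<in> {a<..<b}"
  shows "\<Psi> x = (\<Sum>k<N. poly (hermite_minus N a b k) x * (deriv ^^ k) \<phi> a)
             + (\<Sum>k<N. poly (hermite_plus N a b k) x * (deriv ^^ k) \<phi> b)"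
proof -
  obtain P where deg: "degree P \<le> 2 * N - 1"
    and P: "\<And>y. y \<in> {a<..<b} \<Longrightarrow> \<Psi> y = poly P y"
    by (rule vanishing_deriv_imp_polynomial[of "2 * N" a b \<Psi>])
      (use assms in \<open>auto simp: solves_exit_bvp_def\<close>)
  have jet_a: "poly ((pderiv ^^ k) P) a = (deriv ^^ k) \<phi> a" if "k < N" for k
  proof (rule tendsto_unique)
    show "((deriv ^^ k) \<Psi> \<longlongrightarrow> (deriv ^^ k) \<phi> a) (at_right a)"
      using assms that by (simp add: solves_exit_bvp_def)
    have "\<forall>\<^sub>F y in at_right a. (deriv ^^ k) \<Psi> y = poly ((pderiv ^^ k) P) y"
      using eventually_at_right_less[of a] eventually_at_right_real[OF \<open>a < b\<close>]
      by eventually_elim (auto intro!: higher_deriv_eq_poly P)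
    moreover have "(poly ((pderiv ^^ k) P) \<longlongrightarrow> poly ((pderiv ^^ k) P) a) (at_right a)"
      by (intro tendsto_intros)
    ultimately show "((deriv ^^ k) \<Psi> \<longlongrightarrow> poly ((pderiv ^^ k) P) a) (at_right a)"
      by (simp add: tendsto_cong)
  qed simp
  have jet_b: "poly ((pderiv ^^ k) P) b = (deriv ^^ k) \<phi> b" if "k < N" for k
  proof (rule tendsto_unique)
    show "((deriv ^^ k) \<Psi> \<longlongrightarrow> (deriv ^^ k) \<phi> b) (at_left b)"
      using assms that by (simp add: solves_exit_bvp_def)
    have "\<forall>\<^sub>F y in at_left b. (deriv ^^ k) \<Psi> y = poly ((pderiv ^^ k) P) y"
      using eventually_at_left_real[OF \<open>a < b\<close>]
      by eventually_elim (auto intro!: higher_deriv_eq_poly P)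
    moreover have "(poly ((pderiv ^^ k) P) \<longlongrightarrow> poly ((pderiv ^^ k) P) b) (at_left b)"
      by (intro tendsto_intros)
    ultimately show "((deriv ^^ k) \<Psi> \<longlongrightarrow> poly ((pderiv ^^ k) P) b) (at_left b)"
      by (simp add: tendsto_cong)
  qed simp
  have "P = (\<Sum>k<N. smult (poly ((pderiv ^^ k) P) a) (hermite_minus N a b k))
      + (\<Sum>k<N. smult (poly ((pderiv ^^ k) P) b) (hermite_plus N a b k))"
    using assms deg
    by (intro hermite_interpolation) (auto simp: hermite_eq_explicit is_hermite_explicit)
  also have "\<dots> = (\<Sum>k<N. smult ((deriv ^^ k) \<phi> a) (hermite_minus N a b k))
      + (\<Sum>k<N. smult ((deriv ^^ k) \<phi> b) (hermite_plus N a b k))"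
    by (simp add: jet_a jet_b)
  finally have "poly P x = poly \<dots> x"
    by (rule arg_cong)
  then show ?thesis
    unfolding P[OF assms(4)] by (simp add: poly_sum mult.commute)
qed

section \<open>The distribution of the exit location\<close>

theorem theorem4:
  fixes N :: nat and a b :: real and p :: "real \<Rightarrow> real \<Rightarrow> real"
  assumes "N \<ge> 2" and "a < b"
    and "pseudo_kernel N p"
    and "\<And>\<phi> x. test_function \<phi> \<Longrightarrow> x \<in> {a<..<b} \<Longrightarrow>
           convergent (\<lambda>n. approx_exit_expectation p a b \<phi> n x)"
    and "\<And>\<phi>. test_function \<phi> \<Longrightarrow> solves_exit_bvp N a b \<phi> (exit_expectation p a b \<phi>)"
  shows "(\<forall>k<N. (\<exists>!P. is_hermite N a b k P) \<and> (\<exists>!P. is_hermite N b a k P)) \<and>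
    (\<forall>k<N. \<forall>x.
       poly (hermite_minus N a b k) x
         = ((b - x) / (b - a)) ^ N * ((x - a) ^ k / fact k)
           * (\<Sum>l = 0..N - k - 1. real ((l + N - 1) choose l) * ((x - a) / (b - a)) ^ l) \<and>
       poly (hermite_plus N a b k) x
         = ((x - a) / (b - a)) ^ N * ((x - b) ^ k / fact k)
           * (\<Sum>l = 0..N - k - 1. real ((l + N - 1) choose l) * ((b - x) / (b - a)) ^ l)) \<and>
    (\<forall>x\<in>{a<..<b}.
       distribution_eq (\<lambda>\<phi>. exit_expectation p a b \<phi> x)
         (\<lambda>\<phi>. (\<Sum>k = 0..N - 1. (-1) ^ k * poly (hermite_minus N a b k) x * dirac_deriv k a \<phi>)
             + (\<Sum>k = 0..N - 1. (-1) ^ k * poly (hermite_plus N a b k) x * dirac_deriv k b \<phi>))) \<and>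
    (\<forall>x\<in>{a<..<b}. \<forall>\<phi>. test_function \<phi> \<longrightarrow>
       exit_expectation p a b \<phi> x
         = (\<Sum>k = 0..N - 1. poly (hermite_minus N a b k) x * (deriv ^^ k) \<phi> a)
         + (\<Sum>k = 0..N - 1. poly (hermite_plus N a b k) x * (deriv ^^ k) \<phi> b))"
proof (intro conjI)
  have ex1: "\<exists>!P. is_hermite N c d k P" if "c \<noteq> d" "k < N" for c d k
    using is_hermite_explicit[OF that] is_hermite_unique[OF that] by blast
  show "\<forall>k<N. (\<exists>!P. is_hermite N a b k P) \<and> (\<exists>!P. is_hermite N b a k P)"
    using \<open>a < b\<close> by (simp add: ex1)
next
  have swap: "(a - x) / (a - b) = (x - a) / (b - a)" "(x - b) / (a - b) = (b - x) / (b - a)" for x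
    by (metis minus_diff_eq minus_divide_divide)+
  show "\<forall>k<N. \<forall>x.
       poly (hermite_minus N a b k) x
         = ((b - x) / (b - a)) ^ N * ((x - a) ^ k / fact k)
           * (\<Sum>l = 0..N - k - 1. real ((l + N - 1) choose l) * ((x - a) / (b - a)) ^ l) \<and>
       poly (hermite_plus N a b k) x
         = ((x - a) / (b - a)) ^ N * ((x - b) ^ k / fact k)
           * (\<Sum>l = 0..N - k - 1. real ((l + N - 1) choose l) * ((b - x) / (b - a)) ^ l)"
    using \<open>a < b\<close> by (simp add: hermite_eq_explicit poly_hermite_explicit swap)
next
  have range: "{0..N - 1} = {..<N}"
    using \<open>N \<ge> 2\<close> by auto
  show main: "\<forall>x\<in>{a<..<b}. \<forall>\<phi>. test_function \<phi> \<longrightarrow>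
       exit_expectation p a b \<phi> x
         = (\<Sum>k = 0..N - 1. poly (hermite_minus N a b k) x * (deriv ^^ k) \<phi> a)
         + (\<Sum>k = 0..N - 1. poly (hermite_plus N a b k) x * (deriv ^^ k) \<phi> b)"
    using assms unfolding range by (auto intro!: exit_bvp_solution)
  have sign: "(-1) ^ k * h * dirac_deriv k c \<phi> = h * (deriv ^^ k) \<phi> c" for k h c \<phi>
  proof -
    have "(-1) ^ k * h * dirac_deriv k c \<phi> = ((-1) ^ k * (-1) ^ k) * (h * (deriv ^^ k) \<phi> c)"
      by (simp add: dirac_deriv_def)
    also have "(-1::real) ^ k * (-1) ^ k = 1"
      by (simp flip: power_mult_distrib)
    finally show ?thesis by simp
  qed
  show "\<forall>x\<in>{a<..<b}.
       distribution_eq (\<lambda>\<phi>. exit_expectation p a b \<phi> x)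
         (\<lambda>\<phi>. (\<Sum>k = 0..N - 1. (-1) ^ k * poly (hermite_minus N a b k) x * dirac_deriv k a \<phi>)
             + (\<Sum>k = 0..N - 1. (-1) ^ k * poly (hermite_plus N a b k) x * dirac_deriv k b \<phi>))"
    unfolding distribution_eq_def sign using main by blast
qed

end
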